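(* A set $A \subseteq \omega$ is generically computable if and only if $A$ is densely approximable by c.e. sets, i.e. if and only if there exist c.e. sets $C_0 \subseteq \overline{A}$ and $C_1 \subseteq A$ such that $C_0 \cup C_1$ has density $1$.
   Context: $\omega = \{0,1,2,\dots\}$, $\overline{A} = \omega \setminus A$, and c.e. means computably enumerable. The density of $S \subseteq \omega$ is $\rho(S) = \lim_{n\to\infty} \frac{|S \cap [0,n]|}{n+1}$, when this limit exists. A generic description of $A$ is a partial function $\Phi$ from $\omega$ to $\{0,1\}$ such that $\Phi(x) = \chi_A(x)$ whenever $\Phi(x)$ is defined and the domain of $\Phi$ has density $1$; here $\chi_A$ is the characteristic function of $A$. $A$ is generically computable if it has a generic description which is a partial computable function (the domain is not required to be computable). *)

theory Defs
  imports Complex_Main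
begin

text \<open>
  Kleene's partial recursive functions, as the least class of partial functions containing the
  initial functions and closed under composition, primitive recursion and minimisation.
  In \<open>partial_recursive n f\<close> the number \<open>n\<close> is the arity: an \<open>n\<close>-ary partial function on \<open>nat\<close> is
  represented by a partial function on lists, of which only the values at lists of length \<open>n\<close>
  are meaningful.
\<close>

text \<open>The least zero of \<open>h\<close>, defined only if \<open>h\<close> is defined at every smaller argument.\<close>

definition minimisation :: "(nat \<rightharpoonup> nat) \<Rightarrow> nat option" where
  "minimisation h =
     (if \<exists>y. h y = Some 0 \<and> (\<forall>z<y. h z \<noteq> None) then Some (LEAST y. h y = Some 0) else None)"

inductive partial_recursive :: "nat \<Rightarrow> (nat list \<rightharpoonup> nat) \<Rightarrow> bool" where
  zero: "partial_recursive n (\<lambda>xs. Some 0)"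
| succ: "partial_recursive 1 (\<lambda>xs. Some (Suc (hd xs)))"
| proj: "i < n \<Longrightarrow> partial_recursive n (\<lambda>xs. Some (xs ! i))"
| comp: "partial_recursive (length gs) f \<Longrightarrow> (\<And>g. g \<in> set gs \<Longrightarrow> partial_recursive n g) \<Longrightarrow>
    partial_recursive n (\<lambda>xs. Option.bind (those (map (\<lambda>g. g xs) gs)) f)"
| prec: "partial_recursive n f \<Longrightarrow> partial_recursive (n + 2) g \<Longrightarrow>
    partial_recursive (n + 1)
      (\<lambda>xs. rec_nat (f (tl xs)) (\<lambda>k r. Option.bind r (\<lambda>v. g (k # v # tl xs))) (hd xs))"
| mini: "partial_recursive (n + 1) f \<Longrightarrow>
    partial_recursive n (\<lambda>xs. minimisation (\<lambda>y. f (y # xs)))"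

definition partial_computable :: "(nat \<rightharpoonup> nat) \<Rightarrow> bool" where
  "partial_computable \<phi> \<longleftrightarrow> (\<exists>f. partial_recursive 1 f \<and> (\<forall>x. \<phi> x = f [x]))"

definition ce :: "nat set \<Rightarrow> bool" where
  "ce C \<longleftrightarrow> (\<exists>\<phi>. partial_computable \<phi> \<and> C = dom \<phi>)"

definition has_density :: "nat set \<Rightarrow> real \<Rightarrow> bool" where
  "has_density S d \<longleftrightarrow> (\<lambda>n. real (card (S \<inter> {0..n})) / real (n + 1)) \<longlonglongrightarrow> d"

definition char_fun :: "nat set \<Rightarrow> nat \<Rightarrow> nat" where
  "char_fun A x = (if x \<in> A then 1 else 0)"

definition generic_description :: "(nat \<rightharpoonup> nat) \<Rightarrow> nat set \<Rightarrow> bool" where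
  "generic_description \<Phi> A \<longleftrightarrow>
     ran \<Phi> \<subseteq> {0, 1} \<and> (\<forall>x\<in>dom \<Phi>. \<Phi> x = Some (char_fun A x)) \<and> has_density (dom \<Phi>) 1"

definition generically_computable :: "nat set \<Rightarrow> bool" where
  "generically_computable A \<longleftrightarrow> (\<exists>\<Phi>. generic_description \<Phi> A \<and> partial_computable \<Phi>)"

definition densely_approximable_by_ce :: "nat set \<Rightarrow> bool" where
  "densely_approximable_by_ce A \<longleftrightarrow>
     (\<exists>C\<^sub>0 C\<^sub>1. ce C\<^sub>0 \<and> ce C\<^sub>1 \<and> C\<^sub>0 \<subseteq> - A \<and> C\<^sub>1 \<subseteq> A \<and> has_density (C\<^sub>0 \<union> C\<^sub>1) 1)"

end

theory Submission
  imports Defs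
begin

text \<open>
  If \<open>\<Phi>\<close> is a computable generic description of \<open>A\<close>, then the fibres \<open>\<Phi>\<inverse>(0)\<close> and \<open>\<Phi>\<inverse>(1)\<close> are c.e. and
  their union is the domain of \<open>\<Phi>\<close>. Conversely, given c.e. sets \<open>C\<^sub>0 \<subseteq> - A\<close> and \<open>C\<^sub>1 \<subseteq> A\<close>, an argument
  \<open>x\<close> is searched for in \<open>C\<^sub>0\<close> and \<open>C\<^sub>1\<close> simultaneously, and the answer is the index of the set in which
  it appears; since the two sets are disjoint, this is a partial function with domain \<open>C\<^sub>0 \<union> C\<^sub>1\<close>.

  The simultaneous search needs computations that can be interrupted, which Kleene's schemes do not
  offer: composition with a diverging function diverges. The remedy is to show, by
  induction on the schemes, that each partial recursive \<open>f\<close> has a \<^emph>\<open>total\<close> recursive approximation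
  \<open>F\<close> with an additional stage argument \<open>s\<close>, where \<open>F(s, xs) = 0\<close> means that no value has been found
  by stage \<open>s\<close> and \<open>F(s, xs) = v + 1\<close> means that \<open>f(xs) = v\<close> (lemma \<open>partial_recursive_approximation\<close>).
  This avoids any coding of programs. It turns c.e. sets into projections of decidable
  relations (\<open>ce_iff_projection\<close>), and for those the simultaneous search is a single minimisation
  over the stage (\<open>partial_computable_search\<close>).
\<close>

section \<open>Total recursive functions\<close>

text \<open>
  Representatives in \<^const>\<open>partial_recursive\<close> are determined also on lists of the wrong length, where
  their values are artefacts of the scheme used; hence agreement is demanded at length \<open>n\<close> only.
\<close>

definition recursive :: "nat \<Rightarrow> (nat list \<Rightarrow> nat) \<Rightarrow> bool" where
  "recursive n f \<longleftrightarrow> (\<exists>g. partial_recursive n g \<and> (\<forall>xs. length xs = n \<longrightarrow> g xs = Some (f xs)))"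

lemma recursiveI:
  "partial_recursive n g \<Longrightarrow> (\<And>xs. length xs = n \<Longrightarrow> g xs = Some (f xs)) \<Longrightarrow> recursive n f"
  unfolding recursive_def by blast

lemma recursive_cong:
  assumes "recursive n f" "\<And>xs. length xs = n \<Longrightarrow> f xs = g xs"
  shows "recursive n g"
  using assms unfolding recursive_def by metis

lemma recursive_proj: "i < n \<Longrightarrow> recursive n (\<lambda>xs. xs ! i)"
  by (rule recursiveI[OF partial_recursive.proj]) auto

lemma those_map_Some: "those (map (\<lambda>x. Some (f x)) xs) = Some (map f xs)"
  by (induction xs) auto

lemma recursive_comp:
  assumes f: "recursive (length gs) f" and gs: "\<And>g. g \<in> set gs \<Longrightarrow> recursive n g"
  shows "recursive n (\<lambda>xs. f (map (\<lambda>g. g xs) gs))"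
proof -
  obtain f' where f': "partial_recursive (length gs) f'"
    "\<And>xs. length xs = length gs \<Longrightarrow> f' xs = Some (f xs)"
    using f unfolding recursive_def by blast
  obtain r where r: "\<And>g. g \<in> set gs \<Longrightarrow> partial_recursive n (r g)"
    "\<And>g xs. g \<in> set gs \<Longrightarrow> length xs = n \<Longrightarrow> r g xs = Some (g xs)"
    using gs unfolding recursive_def by metis
  have pr: "partial_recursive n (\<lambda>xs. Option.bind (those (map (\<lambda>g. g xs) (map r gs))) f')"
    by (rule partial_recursive.comp) (use f' r in auto)
  have "those (map (\<lambda>g. g xs) (map r gs)) = Some (map (\<lambda>g. g xs) gs)"
    if "length xs = n" for xs
  proof -
    have "map (\<lambda>g. g xs) (map r gs) = map (\<lambda>g. Some (g xs)) gs"
      using r(2) that by simp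
    then show ?thesis
      by (simp only: those_map_Some)
  qed
  then show ?thesis
    by (intro recursiveI[OF pr]) (simp add: f'(2) del: map_map)
qed

text \<open>
  The stage constructions rearrange the first few arguments and hand on the remaining, arbitrarily
  many parameters unchanged; this form of composition covers all of them.
\<close>

lemma recursive_comp_drop:
  assumes f: "recursive (length gs + m) f" and gs: "\<And>g. g \<in> set gs \<Longrightarrow> recursive n g"
    and n: "n = k + m"
  shows "recursive n (\<lambda>xs. f (map (\<lambda>g. g xs) gs @ drop k xs))"
proof -
  let ?hs = "gs @ map (\<lambda>i xs. xs ! (k + i)) [0..<m]"
  have "recursive n (\<lambda>xs. f (map (\<lambda>g. g xs) ?hs))"
    by (rule recursive_comp) (use f gs n in \<open>auto intro: recursive_proj\<close>)
  then show ?thesis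
  proof (rule recursive_cong)
    fix xs :: "nat list" assume "length xs = n"
    then have "map (\<lambda>i. xs ! (k + i)) [0..<m] = drop k xs"
      using n by (intro nth_equalityI) auto
    then show "f (map (\<lambda>g. g xs) ?hs) = f (map (\<lambda>g. g xs) gs @ drop k xs)"
      by (simp add: comp_def)
  qed
qed

lemma recursive_prec:
  assumes "recursive n f" "recursive (n + 2) g"
  shows "recursive (n + 1) (\<lambda>xs. rec_nat (f (tl xs)) (\<lambda>k r. g (k # r # tl xs)) (hd xs))"
proof -
  obtain f' g' where f': "partial_recursive n f'" "\<And>xs. length xs = n \<Longrightarrow> f' xs = Some (f xs)"
    and g': "partial_recursive (n + 2) g'" "\<And>xs. length xs = n + 2 \<Longrightarrow> g' xs = Some (g xs)"
    using assms unfolding recursive_def by blast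
  show ?thesis
  proof (rule recursiveI[OF partial_recursive.prec[OF f'(1) g'(1)]])
    fix xs :: "nat list" assume len: "length xs = n + 1"
    have "rec_nat (f' (tl xs)) (\<lambda>k r. Option.bind r (\<lambda>v. g' (k # v # tl xs))) m
      = Some (rec_nat (f (tl xs)) (\<lambda>k r. g (k # r # tl xs)) m)" for m
      using len by (induction m) (auto simp: f'(2) g'(2))
    then show "rec_nat (f' (tl xs)) (\<lambda>k r. Option.bind r (\<lambda>v. g' (k # v # tl xs))) (hd xs)
      = Some (rec_nat (f (tl xs)) (\<lambda>k r. g (k # r # tl xs)) (hd xs))" .
  qed
qed

lemma recursive_Suc:
  assumes "recursive n f"
  shows "recursive n (\<lambda>xs. Suc (f xs))"
proof -
  have "recursive (length [f]) (\<lambda>xs. Suc (hd xs))"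
    using recursiveI[OF partial_recursive.succ] by simp
  from recursive_comp[OF this, of n] assms show ?thesis
    by simp
qed

lemma recursive_const: "recursive n (\<lambda>xs. c)"
proof (induction c)
  case 0
  show ?case
    by (rule recursiveI[OF partial_recursive.zero]) simp
next
  case (Suc c)
  then show ?case
    by (rule recursive_Suc)
qed

lemma recursive_pred:
  assumes "recursive n f"
  shows "recursive n (\<lambda>xs. f xs - 1)"
proof -
  have "recursive (0 + 1) (\<lambda>xs. rec_nat 0 (\<lambda>k r. (k # r # tl xs) ! 0) (hd xs))"
    by (rule recursive_prec[where f = "\<lambda>_. 0"]) (auto intro: recursive_const recursive_proj)
  moreover have "rec_nat 0 (\<lambda>k r. k) m = m - 1" for m :: nat
    by (cases m) auto
  ultimately have "recursive (length [f]) (\<lambda>xs. hd xs - 1)"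
    by simp
  from recursive_comp[OF this, of n] assms show ?thesis
    by simp
qed

lemma recursive_if_zero:
  assumes "recursive n f" "recursive n g" "recursive n h"
  shows "recursive n (\<lambda>xs. if f xs = 0 then g xs else h xs)"
proof -
  have "recursive (2 + 1) (\<lambda>xs. rec_nat (tl xs ! 0) (\<lambda>k r. (k # r # tl xs) ! 3) (hd xs))"
    by (rule recursive_prec) (auto intro: recursive_proj)
  moreover have "rec_nat a (\<lambda>k r. b) m = (if m = 0 then a else b)" for a b m :: nat
    by (cases m) auto
  ultimately have "recursive (length [f, g, h])
      (\<lambda>xs. if hd xs = 0 then tl xs ! 0 else tl xs ! Suc 0)"
    by (simp add: numeral_3_eq_3)
  from recursive_comp[OF this, of n] assms show ?thesis
    by (auto cong: if_cong)
qed

lemma recursive_if_all_nonzero: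
  assumes "recursive n h" "\<And>g. g \<in> set gs \<Longrightarrow> recursive n g"
  shows "recursive n (\<lambda>xs. if \<forall>g\<in>set gs. g xs \<noteq> 0 then h xs else 0)"
  using assms(2)
proof (induction gs)
  case Nil
  then show ?case
    using assms(1) by simp
next
  case (Cons g gs)
  then have "recursive n (\<lambda>xs. if g xs = 0 then 0
      else (if \<forall>g\<in>set gs. g xs \<noteq> 0 then h xs else 0))"
    by (intro recursive_if_zero recursive_const) auto
  then show ?case
    by (rule recursive_cong) auto
qed

lemma recursive_eq_const:
  assumes "recursive n f"
  shows "recursive n (\<lambda>xs. if f xs = v then 0 else 1)"
  using assms
proof (induction v arbitrary: f)
  case 0
  then show ?case
    by (intro recursive_if_zero recursive_const)
next
  case (Suc v)
  from Suc.prems have "recursive n (\<lambda>xs. if f xs = 0 then 1 else if f xs - 1 = v then 0 else 1)"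
    by (intro recursive_if_zero recursive_const Suc.IH[OF recursive_pred])
  then show ?case
    by (rule recursive_cong) auto
qed

section \<open>Approximation of partial recursive functions in stages\<close>

text \<open>
  Completeness asks that the value be reported from some stage on, and not just at one stage, because
  the schemes combine finitely many computations that must all have finished at a common stage.
\<close>

definition approximates :: "nat \<Rightarrow> (nat list \<rightharpoonup> nat) \<Rightarrow> (nat list \<Rightarrow> nat) \<Rightarrow> bool" where
  "approximates n f F \<longleftrightarrow> (\<forall>xs v. length xs = n \<longrightarrow>
     (\<forall>s. F (s # xs) = Suc v \<longrightarrow> f xs = Some v) \<and>
     (f xs = Some v \<longrightarrow> (\<forall>\<^sub>F s in sequentially. F (s # xs) = Suc v)))"

lemma approximatesI:
  assumes "\<And>xs s v. length xs = n \<Longrightarrow> F (s # xs) = Suc v \<Longrightarrow> f xs = Some v"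
    and "\<And>xs v. length xs = n \<Longrightarrow> f xs = Some v \<Longrightarrow> \<forall>\<^sub>F s in sequentially. F (s # xs) = Suc v"
  shows "approximates n f F"
  using assms unfolding approximates_def by blast

lemma approximates_sound:
  "approximates n f F \<Longrightarrow> length xs = n \<Longrightarrow> F (s # xs) = Suc v \<Longrightarrow> f xs = Some v"
  unfolding approximates_def by blast

lemma approximates_complete:
  "approximates n f F \<Longrightarrow> length xs = n \<Longrightarrow> f xs = Some v \<Longrightarrow>
    \<forall>\<^sub>F s in sequentially. F (s # xs) = Suc v"
  unfolding approximates_def by blast

lemma those_eq_Some_iff: "those os = Some vs \<longleftrightarrow> os = map Some vs"
proof (induction os arbitrary: vs)
  case Nil
  then show ?case
    by auto
next
  case (Cons a os)
  then show ?case
    by (cases a; cases vs) auto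
qed

text \<open>
  A composition has a value at stage \<open>s\<close> once all inner functions and the outer one have theirs.
\<close>

lemma approximation_comp:
  assumes F: "recursive (length gs + 1) F" "approximates (length gs) f F"
    and G: "\<And>g. g \<in> set gs \<Longrightarrow> recursive (n + 1) (G g)"
      "\<And>g. g \<in> set gs \<Longrightarrow> approximates n g (G g)"
  shows "\<exists>H. recursive (n + 1) H \<and>
    approximates n (\<lambda>xs. Option.bind (those (map (\<lambda>g. g xs) gs)) f) H"
proof -
  let ?args = "\<lambda>ys. map (\<lambda>g. G g ys - 1) gs"
  define H where "H = (\<lambda>ys. if \<forall>g\<in>set (map G gs). g ys \<noteq> 0 then F (ys ! 0 # ?args ys) else 0)"
  have "recursive (n + 1) (\<lambda>ys. F (map (\<lambda>h. h ys) ((\<lambda>ys. ys ! 0) # map (\<lambda>g ys. G g ys - 1) gs)))"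
    by (rule recursive_comp)
      (use F G in \<open>auto intro!: recursive_proj recursive_pred[unfolded One_nat_def]\<close>)
  then have "recursive (n + 1) (\<lambda>ys. F (ys ! 0 # ?args ys))"
    by (simp add: comp_def)
  then have "recursive (n + 1) H"
    unfolding H_def using G by (intro recursive_if_all_nonzero) auto
  moreover have "approximates n (\<lambda>xs. Option.bind (those (map (\<lambda>g. g xs) gs)) f) H"
  proof (rule approximatesI)
    fix xs s v assume len: "length xs = n" and H: "H (s # xs) = Suc v"
    from H have nz: "\<forall>g\<in>set gs. G g (s # xs) \<noteq> 0" and Fv: "F (s # ?args (s # xs)) = Suc v"
      by (auto simp: H_def split: if_splits)
    have "g xs = Some (G g (s # xs) - 1)" if "g \<in> set gs" for g
      by (rule approximates_sound[OF G(2)[OF that] len, of s]) (use nz that in simp)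
    then have "those (map (\<lambda>g. g xs) gs) = Some (?args (s # xs))"
      by (simp add: those_eq_Some_iff)
    moreover have "f (?args (s # xs)) = Some v"
      by (rule approximates_sound[OF F(2) _ Fv]) simp
    ultimately show "Option.bind (those (map (\<lambda>g. g xs) gs)) f = Some v"
      by simp
  next
    fix xs v assume len: "length xs = n"
      and "Option.bind (those (map (\<lambda>g. g xs) gs)) f = Some v"
    then obtain vs where those: "those (map (\<lambda>g. g xs) gs) = Some vs" and f: "f vs = Some v"
      by (auto simp: bind_eq_Some_conv)
    from those have vs: "map (\<lambda>g. g xs) gs = map Some vs"
      by (simp add: those_eq_Some_iff)
    then have lenvs: "length vs = length gs"
      by (metis length_map)
    have vals: "vs = map (\<lambda>g. the (g xs)) gs"
    proof -
      have "map the (map Some vs) = map the (map (\<lambda>g. g xs) gs)"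
        using vs by simp
      then show ?thesis
        by (simp add: comp_def)
    qed
    have defd: "g xs = Some (the (g xs))" if "g \<in> set gs" for g
    proof -
      have "g xs \<in> set (map Some vs)"
        using that vs[symmetric] by simp
      then show ?thesis
        by auto
    qed
    have "\<forall>\<^sub>F s in sequentially. \<forall>g\<in>set gs. G g (s # xs) = Suc (the (g xs))"
      by (intro eventually_ball_finite ballI approximates_complete[OF G(2) len] defd) auto
    moreover have "\<forall>\<^sub>F s in sequentially. F (s # vs) = Suc v"
      by (rule approximates_complete[OF F(2) lenvs f])
    ultimately show "\<forall>\<^sub>F s in sequentially. H (s # xs) = Suc v"
    proof eventually_elim
      case (elim s)
      then have "?args (s # xs) = vs"
        by (simp add: vals)
      with elim show ?case
        by (simp add: H_def)
    qed
  qed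
  ultimately show ?thesis
    by blast
qed

text \<open>
  The stage is held fixed while the recursion runs; the value \<open>0\<close>, once reached because some
  step has not finished at that stage, is passed on to the end.
\<close>

lemma approximation_prec:
  assumes F: "recursive (n + 1) F" "approximates n f F"
    and G: "recursive (n + 2 + 1) G" "approximates (n + 2) g G"
  shows "\<exists>H. recursive (n + 1 + 1) H \<and> approximates (n + 1)
    (\<lambda>xs. rec_nat (f (tl xs)) (\<lambda>k r. Option.bind r (\<lambda>v. g (k # v # tl xs))) (hd xs)) H"
proof -
  define step where "step = (\<lambda>k r ys. if r = 0 then 0 else G (hd ys # k # (r - 1) # tl ys))"
  define R where "R = (\<lambda>k ys. rec_nat (F ys) (\<lambda>k r. step k r ys) k)"
  define H where "H = (\<lambda>ys. R (ys ! 1) (ys ! 0 # drop 2 ys))"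
  have "recursive (n + 1 + 2) (\<lambda>zs. if zs ! 1 = 0 then 0 else
      G (map (\<lambda>g. g zs) [\<lambda>zs. zs ! 2, \<lambda>zs. zs ! 0, \<lambda>zs. zs ! 1 - 1] @ drop 3 zs))"
    by (intro recursive_if_zero recursive_const recursive_proj recursive_comp_drop[where m = n])
      (use G(1) in \<open>auto intro: recursive_proj recursive_pred[unfolded One_nat_def] simp: algebra_simps\<close>)
  then have "recursive (n + 1 + 2) (\<lambda>zs. step (zs ! 0) (zs ! 1) (drop 2 zs))"
    by (rule recursive_cong) (auto simp: step_def length_Suc_conv)
  from recursive_prec[OF F(1) this] have "recursive (n + 1 + 1) (\<lambda>zs. R (hd zs) (tl zs))"
    by (simp add: R_def)
  then have "recursive (n + 1 + 1) (\<lambda>zs. R (hd (map (\<lambda>g. g zs) [\<lambda>zs. zs ! 1, \<lambda>zs. zs ! 0] @ drop 2 zs))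
      (tl (map (\<lambda>g. g zs) [\<lambda>zs. zs ! 1, \<lambda>zs. zs ! 0] @ drop 2 zs)))"
    by (intro recursive_comp_drop[where m = n and f = "\<lambda>zs. R (hd zs) (tl zs)"])
      (auto intro: recursive_proj)
  then have "recursive (n + 1 + 1) H"
    by (simp add: H_def)
  moreover have "approximates (n + 1)
    (\<lambda>xs. rec_nat (f (tl xs)) (\<lambda>k r. Option.bind r (\<lambda>v. g (k # v # tl xs))) (hd xs)) H"
  proof -
    let ?h = "\<lambda>xs k. rec_nat (f xs) (\<lambda>k r. Option.bind r (\<lambda>v. g (k # v # xs))) k"
    have sound: "?h xs k = Some v" if len: "length xs = n" and "R k (s # xs) = Suc v" for xs k s v
      using that(2)
    proof (induction k arbitrary: v)
      case 0
      then show ?case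
        using approximates_sound[OF F(2) len] by (simp add: R_def)
    next
      case (Suc k)
      then obtain u where u: "R k (s # xs) = Suc u" and Gv: "G (s # k # u # xs) = Suc v"
        by (cases "R k (s # xs)") (auto simp: R_def step_def)
      have "g (k # u # xs) = Some v"
        using approximates_sound[OF G(2) _ Gv] len by simp
      with Suc.IH[OF u] show ?case
        by simp
    qed
    have complete: "\<forall>\<^sub>F s in sequentially. R k (s # xs) = Suc v"
      if len: "length xs = n" and "?h xs k = Some v" for xs k v
      using that(2)
    proof (induction k arbitrary: v)
      case 0
      then show ?case
        using approximates_complete[OF F(2) len] by (simp add: R_def)
    next
      case (Suc k)
      then obtain u where u: "?h xs k = Some u" and gv: "g (k # u # xs) = Some v"
        by (auto simp: bind_eq_Some_conv)
      have "\<forall>\<^sub>F s in sequentially. G (s # k # u # xs) = Suc v"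
        using approximates_complete[OF G(2) _ gv] len by simp
      with Suc.IH[OF u] show ?case
        by eventually_elim (simp add: R_def step_def)
    qed
    show ?thesis
    proof (rule approximatesI)
      fix xs s v assume "length xs = n + 1" "H (s # xs) = Suc v"
      then show "?h (tl xs) (hd xs) = Some v"
        using sound[of "tl xs" "hd xs" s v] by (cases xs) (auto simp: H_def)
    next
      fix xs v assume "length xs = n + 1" "?h (tl xs) (hd xs) = Some v"
      then show "\<forall>\<^sub>F s in sequentially. H (s # xs) = Suc v"
        using complete[of "tl xs" "hd xs" v] by (cases xs) (auto simp: H_def)
    qed
  qed
  ultimately show ?thesis
    by blast
qed

lemma minimisation_eq_Some_iff:
  "minimisation h = Some y \<longleftrightarrow> h y = Some 0 \<and> (\<forall>z<y. \<exists>w. h z = Some (Suc w))"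
proof
  assume min: "minimisation h = Some y"
  then have ex: "\<exists>y. h y = Some 0 \<and> (\<forall>z<y. h z \<noteq> None)" and y: "y = (LEAST y. h y = Some 0)"
    by (auto simp: minimisation_def split: if_splits)
  from ex obtain y' where y': "h y' = Some 0" "\<forall>z<y'. h z \<noteq> None"
    by blast
  have "h y = Some 0"
    unfolding y using y'(1) by (rule LeastI)
  moreover have "y \<le> y'"
    unfolding y using y'(1) by (rule Least_le)
  moreover have "h z \<noteq> Some 0" if "z < y" for z
    using that unfolding y by (rule not_less_Least)
  ultimately show "h y = Some 0 \<and> (\<forall>z<y. \<exists>w. h z = Some (Suc w))"
    using y'(2) by (metis not0_implies_Suc not_None_eq order_less_le_trans)
next
  assume asm: "h y = Some 0 \<and> (\<forall>z<y. \<exists>w. h z = Some (Suc w))"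
  have "(LEAST y. h y = Some 0) = y"
  proof (rule Least_equality)
    show "h y = Some 0"
      using asm by blast
    show "y \<le> z" if "h z = Some 0" for z
      using asm that by (metis nat.distinct(1) not_le option.inject)
  qed
  moreover have "\<exists>y. h y = Some 0 \<and> (\<forall>z<y. h z \<noteq> None)"
    using asm by (metis option.distinct(1))
  ultimately show "minimisation h = Some y"
    unfolding minimisation_def by simp
qed

text \<open>
  A bounded search by primitive recursion: read \<open>h z = 0\<close> as no value yet and \<open>h z = v + 1\<close> as
  the value \<open>v\<close>. The counter starts at \<open>0\<close> and advances past each argument with a known nonzero value,
  that is, with \<open>h z - 1 \<noteq> 0\<close>. After \<open>b\<close> moves it has stopped at the first argument below \<open>b\<close> where
  this fails, or else it has reached \<open>b\<close>.
\<close>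

lemma advancing_counter:
  fixes b :: nat and h :: "nat \<Rightarrow> nat"
  defines "c \<equiv> rec_nat 0 (\<lambda>_ c. if h c - 1 = 0 then c else Suc c)"
  shows "c b \<le> b \<and> (\<forall>z<c b. h z - 1 \<noteq> 0) \<and> (c b < b \<longrightarrow> h (c b) - 1 = 0)"
  by (induction b) (auto simp: c_def less_Suc_eq)

text \<open>
  At stage \<open>s\<close> all evaluations are taken at stage \<open>s\<close>, and the counter is given \<open>s\<close> moves. The argument
  at which it stops is reported only if the value \<open>0\<close> is known there: it may also have stopped for
  want of a value, or have used up its moves.
\<close>

lemma approximation_mini:
  assumes F: "recursive (n + 1 + 1) F" "approximates (n + 1) f F"
  shows "\<exists>H. recursive (n + 1) H \<and> approximates n (\<lambda>xs. minimisation (\<lambda>y. f (y # xs))) H"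
proof -
  define step where "step = (\<lambda>c ys. if F (hd ys # c # tl ys) - 1 = 0 then c else Suc c)"
  define C where "C = (\<lambda>b ys. rec_nat 0 (\<lambda>_ c. step c ys) b)"
  define P where "P = (\<lambda>ys. C (hd ys) ys)"
  define V where "V = (\<lambda>ys. F (hd ys # P ys # tl ys))"
  define H where "H = (\<lambda>ys. if V ys = 0 then 0 else if V ys - 1 = 0 then Suc (P ys) else 0)"
  have "recursive (n + 1 + 2) (\<lambda>zs. if
      F (map (\<lambda>g. g zs) [\<lambda>zs. zs ! 2, \<lambda>zs. zs ! 1] @ drop 3 zs) - 1 = 0
      then zs ! 1 else Suc (zs ! 1))"
    by (intro recursive_if_zero recursive_Suc recursive_pred recursive_proj
        recursive_comp_drop[where m = n])
      (use F(1) in \<open>auto intro: recursive_proj simp: algebra_simps\<close>)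
  then have "recursive (n + 1 + 2) (\<lambda>zs. step (zs ! 1) (drop 2 zs))"
    by (rule recursive_cong) (auto simp: step_def length_Suc_conv)
  from recursive_prec[OF recursive_const[of "n + 1" 0] this]
  have C: "recursive (n + 1 + 1) (\<lambda>zs. C (hd zs) (tl zs))"
    by (simp add: C_def)
  have "recursive (n + 1) (\<lambda>zs. C (hd (map (\<lambda>g. g zs) [\<lambda>zs. zs ! 0, \<lambda>zs. zs ! 0] @ drop 1 zs))
      (tl (map (\<lambda>g. g zs) [\<lambda>zs. zs ! 0, \<lambda>zs. zs ! 0] @ drop 1 zs)))"
    by (intro recursive_comp_drop[where m = n and f = "\<lambda>zs. C (hd zs) (tl zs)"])
      (use C in \<open>auto intro: recursive_proj\<close>)
  then have P: "recursive (n + 1) P"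
    by (rule recursive_cong) (auto simp: P_def length_Suc_conv)
  have "recursive (n + 1) (\<lambda>zs. F (map (\<lambda>g. g zs) [\<lambda>zs. zs ! 0, P] @ drop 1 zs))"
    by (intro recursive_comp_drop[where m = n]) (use F(1) P in \<open>auto intro: recursive_proj\<close>)
  then have V: "recursive (n + 1) V"
    by (rule recursive_cong) (auto simp: V_def length_Suc_conv)
  have "recursive (n + 1) H"
    unfolding H_def by (intro recursive_if_zero recursive_const recursive_pred recursive_Suc P V)
  moreover have H_iff: "H (s # xs) = Suc y \<longleftrightarrow>
      y \<le> s \<and> F (s # y # xs) = 1 \<and> (\<forall>z<y. F (s # z # xs) - 1 \<noteq> 0)" for s xs y
  proof -
    define c where "c = P (s # xs)"
    have c: "c \<le> s" "\<forall>z<c. F (s # z # xs) - 1 \<noteq> 0" "c < s \<longrightarrow> F (s # c # xs) - 1 = 0"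
      using advancing_counter[of "\<lambda>z. F (s # z # xs)" s] by (auto simp: c_def P_def C_def step_def)
    have H: "H (s # xs) = Suc y \<longleftrightarrow> F (s # c # xs) = 1 \<and> y = c"
      by (auto simp: H_def V_def c_def)
    show ?thesis
    proof
      assume "H (s # xs) = Suc y"
      with c H show "y \<le> s \<and> F (s # y # xs) = 1 \<and> (\<forall>z<y. F (s # z # xs) - 1 \<noteq> 0)"
        by blast
    next
      assume asm: "y \<le> s \<and> F (s # y # xs) = 1 \<and> (\<forall>z<y. F (s # z # xs) - 1 \<noteq> 0)"
      then have "\<not> c < y" "\<not> y < c"
        using c by auto
      with asm H show "H (s # xs) = Suc y"
        by simp
    qed
  qed
  moreover have "approximates n (\<lambda>xs. minimisation (\<lambda>y. f (y # xs))) H"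
  proof (rule approximatesI)
    fix xs s y assume len: "length xs = n" and "H (s # xs) = Suc y"
    then have y: "F (s # y # xs) = Suc 0" and less: "\<forall>z<y. F (s # z # xs) - 1 \<noteq> 0"
      by (simp_all add: H_iff)
    have "f (y # xs) = Some 0"
      using approximates_sound[OF F(2) _ y] len by simp
    moreover have "\<exists>w. f (z # xs) = Some (Suc w)" if "z < y" for z
    proof -
      from less that have "F (s # z # xs) = Suc (Suc (F (s # z # xs) - 2))"
        by (auto simp: not_le)
      from approximates_sound[OF F(2) _ this] len show ?thesis
        by auto
    qed
    ultimately show "minimisation (\<lambda>y. f (y # xs)) = Some y"
      by (simp add: minimisation_eq_Some_iff)
  next
    fix xs y assume len: "length xs = n" and "minimisation (\<lambda>y. f (y # xs)) = Some y"
    then have y: "f (y # xs) = Some 0" and less: "\<forall>z<y. \<exists>w. f (z # xs) = Some (Suc w)"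
      by (simp_all add: minimisation_eq_Some_iff)
    have "\<forall>\<^sub>F s in sequentially. F (s # z # xs) - 1 \<noteq> 0" if z: "z < y" for z
    proof -
      obtain w where "f (z # xs) = Some (Suc w)"
        using less z by blast
      from approximates_complete[OF F(2) _ this]
      have "\<forall>\<^sub>F s in sequentially. F (s # z # xs) = Suc (Suc w)"
        using len by simp
      then show ?thesis
        by eventually_elim simp
    qed
    then have "\<forall>\<^sub>F s in sequentially. \<forall>z\<in>{..<y}. F (s # z # xs) - 1 \<noteq> 0"
      by (intro eventually_ball_finite) auto
    moreover have "\<forall>\<^sub>F s in sequentially. F (s # y # xs) = Suc 0"
      using approximates_complete[OF F(2) _ y] len by simp
    moreover have "\<forall>\<^sub>F s in sequentially. y \<le> s"
      by (rule eventually_ge_at_top)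
    ultimately show "\<forall>\<^sub>F s in sequentially. H (s # xs) = Suc y"
      by eventually_elim (simp add: H_iff)
  qed
  ultimately show ?thesis
    by blast
qed

text \<open>
  With projections and constants known at every stage, the three constructions above give the
  induction on Kleene's schemes.
\<close>

lemma partial_recursive_approximation:
  "partial_recursive n f \<Longrightarrow> \<exists>F. recursive (n + 1) F \<and> approximates n f F"
proof (induction rule: partial_recursive.induct)
  case (zero n)
  have "approximates n (\<lambda>xs. Some 0) (\<lambda>_. 1)"
    by (rule approximatesI) auto
  then show ?case
    using recursive_const by blast
next
  case succ
  have "recursive (1 + 1) (\<lambda>ys. Suc (Suc (ys ! 1)))"
    by (intro recursive_Suc recursive_proj) simp
  moreover have "approximates 1 (\<lambda>xs. Some (Suc (hd xs))) (\<lambda>ys. Suc (Suc (ys ! 1)))"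
    by (rule approximatesI) (auto simp: length_Suc_conv)
  ultimately show ?case
    by blast
next
  case (proj i n)
  then have "recursive (n + 1) (\<lambda>ys. Suc (ys ! Suc i))"
    by (intro recursive_Suc recursive_proj) simp
  moreover have "approximates n (\<lambda>xs. Some (xs ! i)) (\<lambda>ys. Suc (ys ! Suc i))"
    by (rule approximatesI) auto
  ultimately show ?case
    by blast
next
  case (comp gs f n)
  obtain F where F: "recursive (length gs + 1) F" "approximates (length gs) f F"
    using comp.IH by blast
  obtain G where "\<forall>g\<in>set gs. recursive (n + 1) (G g) \<and> approximates n g (G g)"
    using comp.IH by metis
  then show ?case
    using approximation_comp[OF F] by blast
next
  case (prec n f g)
  then show ?case
    using approximation_prec by blast
next
  case (mini n f)
  then show ?case
    using approximation_mini by blast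
qed

section \<open>Computably enumerable sets and search\<close>

lemma partial_computable_stages:
  assumes "partial_computable \<phi>"
  obtains F where "recursive 2 F" "\<And>x v. \<phi> x = Some v \<longleftrightarrow> (\<exists>s. F [s, x] = Suc v)"
proof -
  obtain f where f: "partial_recursive 1 f" "\<And>x. \<phi> x = f [x]"
    using assms unfolding partial_computable_def by blast
  obtain F where F: "recursive (1 + 1) F" "approximates 1 f F"
    using partial_recursive_approximation[OF f(1)] by blast
  show thesis
  proof
    show "recursive 2 F"
      using F(1) by (simp add: numeral_2_eq_2)
    show "\<phi> x = Some v \<longleftrightarrow> (\<exists>s. F [s, x] = Suc v)" for x v
    proof
      assume "\<phi> x = Some v"
      then have "\<forall>\<^sub>F s in sequentially. F [s, x] = Suc v"
        using approximates_complete[OF F(2), of "[x]"] f(2) by simp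
      then show "\<exists>s. F [s, x] = Suc v"
        by (rule eventually_happens'[rotated]) simp
    next
      assume "\<exists>s. F [s, x] = Suc v"
      then show "\<phi> x = Some v"
        using approximates_sound[OF F(2), of "[x]"] f(2) by auto
    qed
  qed
qed

text \<open>
  The search for the first stage satisfying a decidable condition, followed by a decision that may
  inspect that stage.
\<close>

lemma partial_computable_search:
  assumes "recursive 2 R" "recursive 2 G"
  shows "partial_computable
    (\<lambda>x. if \<exists>s. R [s, x] = 0 then Some (G [LEAST s. R [s, x] = 0, x]) else None)"
proof -
  obtain R' G' where R': "partial_recursive (1 + 1) R'" "\<And>s x. R' [s, x] = Some (R [s, x])"
    and G': "partial_recursive 2 G'" "\<And>s x. G' [s, x] = Some (G [s, x])"
    using assms unfolding recursive_def by (auto simp: numeral_2_eq_2)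
  let ?gs = "[\<lambda>xs. minimisation (\<lambda>s. R' (s # xs)), \<lambda>xs. Some (xs ! 0)]"
  have "partial_recursive 1 (\<lambda>xs. Option.bind (those (map (\<lambda>g. g xs) ?gs)) G')"
    by (rule partial_recursive.comp)
      (use G'(1) partial_recursive.mini[OF R'(1)] in
        \<open>auto intro: partial_recursive.proj simp: numeral_2_eq_2\<close>)
  then show ?thesis
    unfolding partial_computable_def by (intro exI conjI) (auto simp: minimisation_def R'(2) G'(2))
qed

lemma ce_iff_projection: "ce C \<longleftrightarrow> (\<exists>R. recursive 2 R \<and> C = {x. \<exists>s. R [s, x] = 0})"
proof
  assume "ce C"
  then obtain \<phi> where \<phi>: "partial_computable \<phi>" "C = dom \<phi>"
    unfolding ce_def by blast
  obtain F where F: "recursive 2 F" "\<And>x v. \<phi> x = Some v \<longleftrightarrow> (\<exists>s. F [s, x] = Suc v)"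
    using partial_computable_stages[OF \<phi>(1)] by blast
  have "recursive 2 (\<lambda>ys. if F ys = 0 then 1 else 0)"
    by (intro recursive_if_zero recursive_const F(1))
  moreover have "C = {x. \<exists>s. (if F [s, x] = 0 then 1 else 0) = (0::nat)}"
    unfolding \<phi>(2) by (auto simp: F(2) dom_def gr0_conv_Suc)
  ultimately show "\<exists>R. recursive 2 R \<and> C = {x. \<exists>s. R [s, x] = 0}"
    by blast
next
  assume "\<exists>R. recursive 2 R \<and> C = {x. \<exists>s. R [s, x] = 0}"
  then obtain R where R: "recursive 2 R" "C = {x. \<exists>s. R [s, x] = 0}"
    by blast
  from partial_computable_search[OF R(1) R(1)] show "ce C"
    unfolding ce_def by (intro exI conjI) (auto simp: R(2) dom_def split: if_splits)
qed

lemma ce_fibre: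
  assumes "partial_computable \<phi>"
  shows "ce {x. \<phi> x = Some v}"
proof -
  obtain F where F: "recursive 2 F" "\<And>x v. \<phi> x = Some v \<longleftrightarrow> (\<exists>s. F [s, x] = Suc v)"
    using partial_computable_stages[OF assms] by blast
  have "recursive 2 (\<lambda>ys. if F ys = Suc v then 0 else 1)"
    by (rule recursive_eq_const[OF F(1)])
  moreover have "{x. \<phi> x = Some v} = {x. \<exists>s. (if F [s, x] = Suc v then 0 else 1) = (0::nat)}"
    by (auto simp: F(2))
  ultimately show ?thesis
    unfolding ce_iff_projection by blast
qed

text \<open>
  The search ends as soon as \<open>x\<close> is found in either set. If it ends with \<open>x\<close> found in \<open>C\<^sub>1\<close>, the answer
  is \<open>1\<close>; otherwise \<open>x\<close> has been found in \<open>C\<^sub>0\<close>, hence will not appear in \<open>C\<^sub>1\<close> at any later stage.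
\<close>

lemma partial_computable_separation:
  assumes "ce C\<^sub>0" "ce C\<^sub>1" and disj: "C\<^sub>0 \<inter> C\<^sub>1 = {}"
  shows "partial_computable (\<lambda>x. if x \<in> C\<^sub>1 then Some 1 else if x \<in> C\<^sub>0 then Some 0 else None)"
proof -
  obtain R\<^sub>0 R\<^sub>1 where R: "recursive 2 R\<^sub>0" "recursive 2 R\<^sub>1"
    and C: "C\<^sub>0 = {x. \<exists>s. R\<^sub>0 [s, x] = 0}" "C\<^sub>1 = {x. \<exists>s. R\<^sub>1 [s, x] = 0}"
    using assms(1,2) unfolding ce_iff_projection by blast
  let ?R = "\<lambda>ys. if R\<^sub>0 ys = 0 then 0 else R\<^sub>1 ys"
  let ?G = "\<lambda>ys. if R\<^sub>1 ys = 0 then 1 else (0::nat)"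
  have "(if \<exists>s. ?R [s, x] = 0 then Some (?G [LEAST s. ?R [s, x] = 0, x]) else None)
      = (if x \<in> C\<^sub>1 then Some 1 else if x \<in> C\<^sub>0 then Some 0 else None)" for x
  proof (cases "\<exists>s. ?R [s, x] = 0")
    case True
    define t where "t = (LEAST s. ?R [s, x] = 0)"
    have "?R [t, x] = 0"
      unfolding t_def using True by (rule LeastI_ex)
    then have "if R\<^sub>1 [t, x] = 0 then x \<in> C\<^sub>1 else x \<in> C\<^sub>0"
      by (auto simp: C split: if_splits)
    then show ?thesis
      using True disj unfolding t_def[symmetric] by (auto split: if_splits)
  next
    case False
    then have "R\<^sub>0 [s, x] \<noteq> 0 \<and> R\<^sub>1 [s, x] \<noteq> 0" for s
      by presburger
    then have "x \<notin> C\<^sub>0" "x \<notin> C\<^sub>1"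
      unfolding C by blast+
    with False show ?thesis
      by (simp only: if_False)
  qed
  moreover have "recursive 2 ?R" "recursive 2 ?G"
    by (intro recursive_if_zero recursive_const R)+
  ultimately show ?thesis
    using partial_computable_search[of ?R ?G] by presburger
qed

section \<open>Generic computability\<close>

theorem proposition2p2:
  fixes A :: "nat set"
  shows "generically_computable A \<longleftrightarrow> densely_approximable_by_ce A"
proof
  assume "generically_computable A"
  then obtain \<Phi> where pc: "partial_computable \<Phi>" and gd: "generic_description \<Phi> A"
    unfolding generically_computable_def by blast
  let ?C = "\<lambda>v. {x. \<Phi> x = Some v}"
  have val: "\<Phi> x = Some v \<Longrightarrow> v = char_fun A x" for x v
    using gd unfolding generic_description_def by force
  have "?C 0 \<subseteq> - A" "?C 1 \<subseteq> A"
    by (auto dest!: val simp: char_fun_def split: if_splits)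
  moreover have "?C 0 \<union> ?C 1 = dom \<Phi>"
    using gd unfolding generic_description_def by (fastforce simp: ran_def)
  ultimately show "densely_approximable_by_ce A"
    unfolding densely_approximable_by_ce_def
    using ce_fibre[OF pc] gd unfolding generic_description_def by metis
next
  assume "densely_approximable_by_ce A"
  then obtain C\<^sub>0 C\<^sub>1 where C: "ce C\<^sub>0" "ce C\<^sub>1" "C\<^sub>0 \<subseteq> - A" "C\<^sub>1 \<subseteq> A" "has_density (C\<^sub>0 \<union> C\<^sub>1) 1"
    unfolding densely_approximable_by_ce_def by blast
  define \<Phi> where "\<Phi> = (\<lambda>x. if x \<in> C\<^sub>1 then Some 1 else if x \<in> C\<^sub>0 then Some (0::nat) else None)"
  have "partial_computable \<Phi>"
    unfolding \<Phi>_def by (rule partial_computable_separation) (use C in auto)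
  moreover have "dom \<Phi> = C\<^sub>0 \<union> C\<^sub>1"
    by (auto simp: \<Phi>_def dom_def)
  moreover have "ran \<Phi> \<subseteq> {0, 1}"
    by (auto simp: \<Phi>_def ran_def split: if_splits)
  moreover have "\<Phi> x = Some (char_fun A x)" if "x \<in> dom \<Phi>" for x
    using that C(3,4) by (auto simp: \<Phi>_def char_fun_def split: if_splits)
  ultimately show "generically_computable A"
    unfolding generically_computable_def generic_description_def using C(5) by metis
qed

end
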